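(* Let $K$ be a real quadratic field, with notation as below. Then: (1) for every positive integer $f$, $\mathcal{U}^+_f=\{\pm\varepsilon_f^{\,n} : n\in\mathbb{Z}\}$; (2) for every positive integer $k$, $j_{\min}(f_k)=k$; (3) for all positive integers $f,j$: $f\mid f_j$ if and only if $j_{\min}(f)\mid j$; (4) for all positive integers $j,k$: $j\mid k$ if and only if $f_j\mid f_k$.
   Context: Let $K\subset\mathbb{R}$ be a real quadratic field of discriminant $\Delta_0$, and let $\varepsilon$ be the smallest unit of $K$ of norm $+1$ that is greater than $1$. For positive integers $j$ set $f_j=(\varepsilon^j-\varepsilon^{-j})/\sqrt{\Delta_0}$ (an integer). For a positive integer $f$, $\mathcal{O}_f=\{m+nf\frac{\Delta_0+\sqrt{\Delta_0}}{2}: m,n\in\mathbb{Z}\}$ is the order of conductor $f$ in $K$, and $\mathcal{U}^+_f=\{w\in\mathcal{O}_f:\operatorname{Nm}(w)=1\}$ is its group of norm-$1$ units. For each positive integer $f$ there exists $j$ with $f\mid f_j$; define $j_{\min}(f)=\min\{j\ge1: f\mid f_j\}$ and $\varepsilon_f=\varepsilon^{j_{\min}(f)}$. *)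

theory Defs
  imports Complex_Main "HOL-Computational_Algebra.Polynomial"
begin

text \<open>A real quadratic field is a subfield of the reals of degree 2 over the rationals; the
  dimension below is that of \<open>K\<close> as a rational vector space.\<close>

definition real_quadratic_field :: "real set \<Rightarrow> bool" where
  "real_quadratic_field K \<longleftrightarrow>
     0 \<in> K \<and> 1 \<in> K \<and>
     (\<forall>x\<in>K. \<forall>y\<in>K. x - y \<in> K \<and> x * y \<in> K) \<and> (\<forall>x\<in>K. inverse x \<in> K) \<and>
     vector_space.dim (\<lambda>(q::rat) (x::real). of_rat q * x) K = 2"

definition ring_of_integers :: "real set \<Rightarrow> real set" where
  "ring_of_integers K = {x \<in> K. algebraic_int x}"

text \<open>Galois conjugation: the nontrivial field automorphism of \<open>K\<close>. It is extended by the
  identity outside \<open>K\<close> so that it is unique as a function on the reals.\<close>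

definition quad_conj :: "real set \<Rightarrow> real \<Rightarrow> real" where
  "quad_conj K = (THE \<sigma>. bij_betw \<sigma> K K \<and>
     (\<forall>x\<in>K. \<forall>y\<in>K. \<sigma> (x + y) = \<sigma> x + \<sigma> y \<and> \<sigma> (x * y) = \<sigma> x * \<sigma> y) \<and>
     (\<exists>x\<in>K. \<sigma> x \<noteq> x) \<and> (\<forall>x. x \<notin> K \<longrightarrow> \<sigma> x = x))"

definition quad_norm :: "real set \<Rightarrow> real \<Rightarrow> real" where
  "quad_norm K x = x * quad_conj K x"

definition integral_basis :: "real set \<Rightarrow> real \<Rightarrow> real \<Rightarrow> bool" where
  "integral_basis K \<alpha> \<beta> \<longleftrightarrow>
     bij_betw (\<lambda>(m::int, n::int). of_int m * \<alpha> + of_int n * \<beta>) UNIV (ring_of_integers K)"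

definition quad_disc :: "real set \<Rightarrow> int" where
  "quad_disc K = (THE D. \<exists>\<alpha> \<beta>. integral_basis K \<alpha> \<beta> \<and>
     of_int D = (\<alpha> * quad_conj K \<beta> - \<beta> * quad_conj K \<alpha>)\<^sup>2)"

definition unit_of_field :: "real set \<Rightarrow> real \<Rightarrow> bool" where
  "unit_of_field K u \<longleftrightarrow>
     u \<in> ring_of_integers K \<and> (\<exists>v \<in> ring_of_integers K. u * v = 1)"

definition eps :: "real set \<Rightarrow> real" where
  "eps K = (LEAST u. unit_of_field K u \<and> quad_norm K u = 1 \<and> u > 1)"

text \<open>The value is always a natural number, so \<open>THE\<close> only changes the type.\<close>

definition fseq :: "real set \<Rightarrow> nat \<Rightarrow> nat" where
  "fseq K j = (THE n. real n = (eps K ^ j - inverse (eps K ^ j)) / sqrt (of_int (quad_disc K)))"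

definition order_of_conductor :: "real set \<Rightarrow> nat \<Rightarrow> real set" where
  "order_of_conductor K f =
     {of_int m + of_int n * of_nat f * ((of_int (quad_disc K) + sqrt (of_int (quad_disc K))) / 2)
      | m n :: int. True}"

definition norm_one_units :: "real set \<Rightarrow> nat \<Rightarrow> real set" where
  "norm_one_units K f = {w \<in> order_of_conductor K f. quad_norm K w = 1}"

definition jmin :: "real set \<Rightarrow> nat \<Rightarrow> nat" where
  "jmin K f = (LEAST j. j \<ge> 1 \<and> f dvd fseq K j)"

definition eps_cond :: "real set \<Rightarrow> nat \<Rightarrow> real" where
  "eps_cond K f = eps K ^ jmin K f"

end

theory Submission
  imports Defs "HOL-Analysis.Kronecker_Approximation_Theorem" "HOL-Computational_Algebra.Squarefree"
begin

text \<open>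
  With \<open>D\<close> the discriminant of \<open>K\<close>, the norm-one elements of the order of conductor \<open>f\<close> are the
  numbers \<open>(x + y \<surd>E) / 2\<close> with integers \<open>x\<close>, \<open>y\<close> such that \<open>x\<^sup>2 - E y\<^sup>2 = 4\<close>, where
  \<open>E = D f\<^sup>2\<close>: the congruence that describes membership in the order follows from the norm equation.
  For every \<open>E\<close> these numbers form a group, nontrivial by Pell's equation, and for \<open>f = 1\<close> the
  positive ones are the powers of \<open>\<epsilon>\<close>. Since \<open>\<epsilon>\<^sup>j - \<epsilon>\<^sup>-\<^sup>j = f\<^sub>j \<surd>D\<close>, the power
  \<open>\<epsilon>\<^sup>j\<close> lies in the group of conductor \<open>f\<close> iff \<open>f\<close> divides \<open>f\<^sub>j\<close>. The exponents \<open>j\<close>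
  with this property are therefore the multiples of the least positive one, and the remaining
  claims follow because \<open>f\<^sub>j\<close> is strictly increasing in \<open>j\<close>.
\<close>

section \<open>The Pell equation\<close>

text \<open>
  Good rational approximations \<open>h / k\<close> of \<open>\<surd>E\<close> have bounded norm \<open>h\<^sup>2 - E k\<^sup>2\<close>, so two of
  them agree in their norm \<open>n\<close> and modulo \<open>n\<close>; their quotient is then an integral solution.
\<close>

lemma pell_exists:
  fixes E :: int
  assumes irr: "sqrt (of_int E) \<notin> \<rat>" and pos: "E > 0"
  obtains x y :: int where "x\<^sup>2 - E * y\<^sup>2 = 1" "y \<noteq> 0"
proof -
  let ?A = "approx_set (sqrt (of_int E))"
  define N where "N = (\<lambda>(h, k). h\<^sup>2 - E * k\<^sup>2 :: int)"
  \<comment> \<open>In absolute value \<open>h - k * sqrt E\<close> is below 1 / k and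
    \<open>h + k * sqrt E\<close> is at most 1 + 2 k sqrt E. As k >= 1, the product of the two,
    which is the norm, stays below this constant.\<close>
  define M where "M = \<lceil>1 + 2 * sqrt (of_int E)\<rceil>"
  define g where "g = (\<lambda>(h, k). (N (h, k), h mod N (h, k), k mod N (h, k)))"
  have N_le: "\<bar>N (h, k)\<bar> \<le> M" if "(h, k) \<in> ?A" for h k
  proof -
    from that have k: "k > 0" and less: "\<bar>sqrt (of_int E) - of_int h / of_int k\<bar> < 1 / (of_int k)\<^sup>2"
      by (auto simp: approx_set_def)
    let ?k = "real_of_int k" and ?h = "real_of_int h" and ?s = "sqrt (of_int E)"
    have k1: "?k \<ge> 1" using k by simp
    have "\<bar>?h - ?k * ?s\<bar> = ?k * \<bar>?s - ?h / ?k\<bar>"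
      using k by (simp add: abs_mult_pos field_simps abs_minus_commute flip: abs_mult_pos)
    also have "\<dots> < ?k * (1 / ?k\<^sup>2)"
      using less k by (intro mult_strict_left_mono) auto
    also have "\<dots> = 1 / ?k" using k by (simp add: power2_eq_square)
    finally have 1: "\<bar>?h - ?k * ?s\<bar> < 1 / ?k" .
    have k_le: "1 / ?k \<le> 1" using k1 by simp
    have s0: "?s \<ge> 0" using pos by simp
    have "\<bar>?h + ?k * ?s\<bar> \<le> \<bar>?h - ?k * ?s\<bar> + 2 * ?k * ?s"
      using mult_nonneg_nonneg[of ?k ?s] s0 k1 by linarith
    hence 2: "\<bar>?h + ?k * ?s\<bar> \<le> 1 + 2 * ?k * ?s" using 1 k_le by linarith
    have "\<bar>of_int (N (h, k))\<bar> = \<bar>?h - ?k * ?s\<bar> * \<bar>?h + ?k * ?s\<bar>"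
      using pos by (simp add: N_def algebra_simps power2_eq_square flip: abs_mult)
    also have "\<dots> \<le> (1 / ?k) * (1 + 2 * ?k * ?s)"
      using 1 2 k1 by (intro mult_mono) auto
    also have "\<dots> = 1 / ?k + 2 * ?s" using k by (simp add: field_simps)
    also have "\<dots> \<le> 1 + 2 * ?s" using k_le by simp
    also have "\<dots> \<le> of_int M" by (simp add: M_def)
    finally show ?thesis by linarith
  qed
  have N_nz: "N (h, k) \<noteq> 0" if "(h, k) \<in> ?A" for h k
  proof
    assume "N (h, k) = 0"
    hence "real_of_int (h\<^sup>2) = real_of_int (E * k\<^sup>2)" by (simp add: N_def)
    moreover have k: "k > 0" using that by (auto simp: approx_set_def)
    ultimately have "of_int E = (real_of_int h / of_int k)\<^sup>2"
      by (simp add: field_simps)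
    hence "sqrt (of_int E) = \<bar>real_of_int h / of_int k\<bar>" by simp
    also have "\<dots> \<in> \<rat>" by simp
    finally show False using irr by simp
  qed
  \<comment> \<open>Residues modulo the norm are smaller in absolute value than the norm, so the
    bound \<open>M\<close> serves all three components.\<close>
  have "g ` ?A \<subseteq> {-M..M} \<times> {-M..M} \<times> {-M..M}"
  proof safe
    fix h k a b c assume A: "(h, k) \<in> ?A" and g: "(a, b, c) = g (h, k)"
    have "\<bar>m mod N (h, k)\<bar> \<le> M" for m
      using N_le[OF A] N_nz[OF A] abs_mod_less[of "N (h, k)" m] by linarith
    from this[of h] this[of k] N_le[OF A] g show "a \<in> {-M..M}" "b \<in> {-M..M}" "c \<in> {-M..M}"
      by (auto simp: g_def abs_le_iff)
  qed
  hence "finite (g ` ?A)" by (rule finite_subset) auto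
  moreover have "infinite ?A" using irr rational_iff_finite_approx_set by blast
  ultimately obtain p where p: "p \<in> ?A" "infinite {q \<in> ?A. g q = g p}"
    using pigeonhole_infinite by blast
  obtain h k where hk: "p = (h, k)" by fastforce
  have "{q \<in> ?A. g q = g p} - {p} \<noteq> {}"
    using p(2) by (metis finite.emptyI finite_insert infinite_remove)
  then obtain h' k' where q: "(h', k') \<in> ?A" "g (h', k') = g (h, k)" "(h', k') \<noteq> (h, k)"
    unfolding hk by auto
  define n where "n = N (h, k)"
  have n: "h\<^sup>2 - E * k\<^sup>2 = n" "h'\<^sup>2 - E * k'\<^sup>2 = n" and "n \<noteq> 0"
    using q N_nz p by (auto simp: g_def n_def N_def hk)
  have "n dvd h' - h" "n dvd k' - k"
    using q(2) by (auto simp: g_def n_def mod_eq_dvd_iff)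
  then obtain a b where ab: "h' = h + n * a" "k' = k + n * b"
    by (metis add.commute diff_add_cancel dvdE)
  \<comment> \<open>The quotient of h' + k' sqrt E by h + k sqrt E is ((h h' - E k k') + (h k' - k
    h') sqrt E) / n. Inserting the congruences for h' and k' cancels n and leaves these two
    integers.\<close>
  define x where "x = 1 + h * a - E * k * b"
  define y where "y = h * b - k * a"
  have nx: "n * x = h * h' - E * k * k'" and ny: "n * y = h * k' - k * h'"
    using n(1) by (simp_all add: x_def y_def ab algebra_simps power2_eq_square)
  have "n\<^sup>2 * (x\<^sup>2 - E * y\<^sup>2) = (n * x)\<^sup>2 - E * (n * y)\<^sup>2"
    by (simp add: algebra_simps power2_eq_square)
  also have "\<dots> = (h\<^sup>2 - E * k\<^sup>2) * (h'\<^sup>2 - E * k'\<^sup>2)"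
    unfolding nx ny by (simp add: algebra_simps power2_eq_square)
  also have "\<dots> = n\<^sup>2 * 1" unfolding n by (simp add: power2_eq_square)
  finally have "x\<^sup>2 - E * y\<^sup>2 = 1" using \<open>n \<noteq> 0\<close> by simp
  \<comment> \<open>Otherwise h / k and h' / k' would be the same fraction; both are in lowest terms
    with positive denominator, so the two pairs would coincide.\<close>
  moreover have "y \<noteq> 0"
  proof
    assume "y = 0"
    hence "h * k' = k * h'" using ny by simp
    have cop: "coprime h k" "coprime h' k'" and pos: "k > 0" "k' > 0"
      using p(1) q(1) by (auto simp: hk approx_set_def)
    have "\<bar>h\<bar> * \<bar>k'\<bar> = \<bar>h'\<bar> * \<bar>k\<bar>"
      using \<open>h * k' = k * h'\<close> by (metis abs_mult mult.commute)
    hence "k = k'" using coprime_crossproduct_int[of h k h' k'] cop pos by simp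
    hence "h = h'" using \<open>h * k' = k * h'\<close> pos by simp
    thus False using q(3) \<open>k = k'\<close> by simp
  qed
  ultimately show thesis by (rule that)
qed

section \<open>The group of norm-one elements with half-integral coordinates\<close>

text \<open>The 4 goes with the denominator 2: integers of norm 1 may have half-integral
  coordinates, as (3 + sqrt 5) / 2 does. The equation itself forces x and E y to have the same
  parity.\<close>

definition pell_units :: "int \<Rightarrow> real set" where
  "pell_units E = {(of_int x + of_int y * sqrt (of_int E)) / 2 | x y :: int. x\<^sup>2 - E * y\<^sup>2 = 4}"

lemma pell_unitsI:
  "x\<^sup>2 - E * y\<^sup>2 = 4 \<Longrightarrow> w = (of_int x + of_int y * sqrt (of_int E)) / 2 \<Longrightarrow> w \<in> pell_units E"
  by (auto simp: pell_units_def)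

lemma pell_units_one: "1 \<in> pell_units E"
  by (rule pell_unitsI[of 2 _ 0]) auto

lemma pell_conj_mult:
  fixes x y E :: int
  assumes "x\<^sup>2 - E * y\<^sup>2 = 4" "E > 0"
  shows "((of_int x + of_int y * sqrt (of_int E)) / 2) *
    ((of_int x - of_int y * sqrt (of_int E)) / 2) = (1::real)"
proof -
  have "real_of_int (x\<^sup>2 - E * y\<^sup>2) = 4" using assms(1) by simp
  thus ?thesis using assms(2) by (simp add: field_simps power2_eq_square)
qed

lemma pell_unit_inverse_eq:
  fixes x y E :: int
  assumes "x\<^sup>2 - E * y\<^sup>2 = 4" "E > 0"
  shows "inverse ((of_int x + of_int y * sqrt (of_int E)) / 2) =
    (of_int x - of_int y * sqrt (of_int E)) / (2::real)"
  using pell_conj_mult[OF assms] by (rule inverse_unique)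

lemma pell_unitsE:
  assumes "w \<in> pell_units E" "E > 0"
  obtains x y :: int where "x\<^sup>2 - E * y\<^sup>2 = 4"
    "w = (of_int x + of_int y * sqrt (of_int E)) / 2"
    "inverse w = (of_int x - of_int y * sqrt (of_int E)) / 2"
    "w + inverse w = of_int x" "w - inverse w = of_int y * sqrt (of_int E)"
proof -
  obtain x y where xy: "x\<^sup>2 - E * y\<^sup>2 = 4" "w = (of_int x + of_int y * sqrt (of_int E)) / 2"
    using assms(1) by (auto simp: pell_units_def)
  have "inverse w = (of_int x - of_int y * sqrt (of_int E)) / 2"
    unfolding xy(2) using pell_unit_inverse_eq[OF xy(1) assms(2)] .
  moreover from this have "w + inverse w = of_int x" "w - inverse w = of_int y * sqrt (of_int E)"
    by (simp_all only: xy(2), simp_all add: field_simps)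
  ultimately show thesis using xy by (intro that)
qed

lemma pell_units_nonzero: "w \<in> pell_units E \<Longrightarrow> E > 0 \<Longrightarrow> w \<noteq> 0"
  by (auto simp: pell_units_def dest: pell_conj_mult)

lemma pell_units_uminus: "w \<in> pell_units E \<Longrightarrow> - w \<in> pell_units E"
proof -
  assume "w \<in> pell_units E"
  then obtain x y where "x\<^sup>2 - E * y\<^sup>2 = 4" "w = (of_int x + of_int y * sqrt (of_int E)) / 2"
    by (auto simp: pell_units_def)
  thus ?thesis by (intro pell_unitsI[of "-x" _ "-y"]) auto
qed

lemma pell_units_inverse_closed: "w \<in> pell_units E \<Longrightarrow> E > 0 \<Longrightarrow> inverse w \<in> pell_units E"
proof (erule pell_unitsE, assumption)
  fix x y assume "x\<^sup>2 - E * y\<^sup>2 = 4" "inverse w = (of_int x - of_int y * sqrt (of_int E)) / 2"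
  thus "inverse w \<in> pell_units E" by (intro pell_unitsI[of x _ "- y"]) auto
qed

lemma pell_units_mult:
  assumes "v \<in> pell_units E" "w \<in> pell_units E" "E > 0"
  shows "v * w \<in> pell_units E"
proof -
  obtain a b where v: "a\<^sup>2 - E * b\<^sup>2 = 4" "v = (of_int a + of_int b * sqrt (of_int E)) / 2"
    using assms by (auto simp: pell_units_def)
  obtain c d where w: "c\<^sup>2 - E * d\<^sup>2 = 4" "w = (of_int c + of_int d * sqrt (of_int E)) / 2"
    using assms by (auto simp: pell_units_def)
  \<comment> \<open>A priori the product has denominator 4. Modulo 2 the norm equations give a = E b
    and c = E d, so both coordinates of the product are even and a factor 2 cancels.\<close>
  have "even a \<longleftrightarrow> even (E * b)" if "a\<^sup>2 - E * b\<^sup>2 = 4" for a b :: int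
  proof -
    have "even (a\<^sup>2 - E * b\<^sup>2)" using that by simp
    thus ?thesis by auto
  qed
  from this[OF v(1)] this[OF w(1)] have "even (a * c + E * b * d)" "even (a * d + b * c)"
    by auto
  then obtain x y where x: "a * c + E * b * d = 2 * x" and y: "a * d + b * c = 2 * y"
    by (meson evenE)
  have "4 * (x\<^sup>2 - E * y\<^sup>2) = (2 * x)\<^sup>2 - E * (2 * y)\<^sup>2" by (simp add: power2_eq_square algebra_simps)
  also have "\<dots> = (a\<^sup>2 - E * b\<^sup>2) * (c\<^sup>2 - E * d\<^sup>2)"
    unfolding x[symmetric] y[symmetric] by (simp add: power2_eq_square algebra_simps)
  also have "\<dots> = 16" by (simp add: v w)
  finally have "x\<^sup>2 - E * y\<^sup>2 = 4" by simp
  moreover have "v * w = (of_int x + of_int y * sqrt (of_int E)) / 2"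
  proof -
    have "4 * (v * w) = of_int (a * c + E * b * d) + of_int (a * d + b * c) * sqrt (of_int E)"
      using assms(3) by (simp add: v w algebra_simps)
    thus ?thesis unfolding x y by simp
  qed
  ultimately show ?thesis by (rule pell_unitsI)
qed

lemma pell_units_power: "w \<in> pell_units E \<Longrightarrow> E > 0 \<Longrightarrow> w ^ n \<in> pell_units E"
  by (induction n) (auto intro: pell_units_mult pell_units_one)

lemma pell_units_powi: "w \<in> pell_units E \<Longrightarrow> E > 0 \<Longrightarrow> w powi n \<in> pell_units E"
  by (auto simp: power_int_def intro: pell_units_power pell_units_inverse_closed)

section \<open>The least unit above 1 and cyclicity\<close>

lemma pell_units_greater_one_exists:
  assumes "sqrt (of_int E) \<notin> \<rat>" "E > 0"
  obtains w where "w \<in> pell_units E" "w > 1"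
proof -
  obtain x y where xy: "x\<^sup>2 - E * y\<^sup>2 = 1" "y \<noteq> 0" using pell_exists[OF assms] .
  have "E * y\<^sup>2 \<ge> 0" using assms(2) by simp
  hence "x \<noteq> 0" using xy(1) by auto
  \<comment> \<open>The absolute values push w above 1: the rational part is at least 1 and the
    irrational part is positive. Doubling both coordinates turns norm 1 into the equation with
    4.\<close>
  define w where "w = of_int \<bar>x\<bar> + of_int \<bar>y\<bar> * sqrt (of_int E)"
  have "w \<in> pell_units E"
    by (rule pell_unitsI[of "2 * \<bar>x\<bar>" _ "2 * \<bar>y\<bar>"]) (use xy in \<open>auto simp: w_def power_mult_distrib\<close>)
  moreover have "w > 1"
  proof -
    have "real_of_int \<bar>x\<bar> \<ge> 1" using \<open>x \<noteq> 0\<close> by linarith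
    moreover have "of_int \<bar>y\<bar> * sqrt (of_int E) > 0" using xy(2) assms(2) by simp
    ultimately show ?thesis by (simp add: w_def)
  qed
  ultimately show thesis by (rule that)
qed

text \<open>The difference of the two sides is (w - v) (1 - 1 / (v w)). As
  \<open>w + inverse w\<close> is an integer on \<open>pell_units\<close>, this reduces the search
  for a least unit to one for a least integer.\<close>

lemma plus_inverse_strict_mono:
  fixes v w :: real
  assumes "1 < v" "v < w"
  shows "v + inverse v < w + inverse w"
proof -
  have "w + inverse w - (v + inverse v) = (w - v) * (1 - inverse (v * w))"
    using assms by (simp add: field_simps)
  moreover have "v * w > 1" using assms by (simp add: less_1_mult)
  hence "inverse (v * w) < 1" by (rule inverse_less_1_iff[THEN iffD2, OF disjI2])
  ultimately show ?thesis using assms by (smt (verit) mult_pos_pos)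
qed

lemma pell_units_least_exists:
  assumes "sqrt (of_int E) \<notin> \<rat>" "E > 0"
  obtains w where "w \<in> pell_units E" "w > 1" "\<And>v. v \<in> pell_units E \<Longrightarrow> v > 1 \<Longrightarrow> w \<le> v"
proof -
  let ?P = "\<lambda>w. w \<in> pell_units E \<and> w > 1"
  \<comment> \<open>the trace is a positive integer and increases with the unit\<close>
  define m where "m = (\<lambda>w::real. nat \<lfloor>w + inverse w\<rfloor>)"
  obtain w0 where "?P w0" using pell_units_greater_one_exists[OF assms] by blast
  then obtain w where w: "?P w" "\<And>v. ?P v \<Longrightarrow> m w \<le> m v"
    using ex_has_least_nat[of ?P w0 m] by blast
  have m: "real (m v) = v + inverse v" if v: "?P v" for v
  proof -
    obtain x :: int where "v + inverse v = of_int x"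
      by (rule pell_unitsE[OF conjunct1[OF v] assms(2)]) blast
    moreover have "v + inverse v > 0" using v by (simp add: add_pos_pos)
    ultimately show ?thesis by (simp add: m_def)
  qed
  have "w \<le> v" if v: "?P v" for v
  proof (rule ccontr)
    assume "\<not> w \<le> v"
    hence "v + inverse v < w + inverse w" using v by (intro plus_inverse_strict_mono) auto
    thus False using w(2)[OF v] m[OF v] m[OF w(1)] by linarith
  qed
  thus thesis using w by (intro that) auto
qed

text \<open>Divide w by the largest power of e that does not exceed it; the exponent is the floor of
  a logarithm. The quotient is a group element in [1, e), and minimality of e leaves only 1.\<close>

lemma pell_units_cyclic:
  assumes "E > 0" and e: "e \<in> pell_units E" "e > 1"
    and least: "\<And>v. v \<in> pell_units E \<Longrightarrow> v > 1 \<Longrightarrow> e \<le> v"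
    and w: "w \<in> pell_units E" "w > 0"
  obtains n where "w = e powi n"
proof -
  define n where "n = \<lfloor>log e w\<rfloor>"
  have "e powi n = e powr of_int n" using e by (simp add: powr_real_of_int')
  also have "\<dots> \<le> e powr log e w" using e by (simp add: n_def)
  also have "\<dots> = w" using e w by simp
  finally have le: "e powi n \<le> w" .
  have "w = e powr log e w" using e w by simp
  also have "\<dots> < e powr of_int (n + 1)" using e by (intro powr_less_mono) (auto simp: n_def)
  also have "\<dots> = e powi (n + 1)" using e powr_real_of_int'[of e "n + 1"] by simp
  also have "\<dots> = e powi n * e" using e by (simp add: power_int_add)
  finally have less: "w < e powi n * e" .
  have pos: "e powi n > 0" using e by (simp add: zero_less_power_int)
  define v where "v = w * inverse (e powi n)"
  have "v \<in> pell_units E" unfolding v_def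
    using assms by (intro pell_units_mult pell_units_inverse_closed pell_units_powi) auto
  moreover have "v < e" "v \<ge> 1" using le less pos by (simp_all add: v_def field_simps)
  ultimately have "v = 1" using least[of v] by linarith
  hence "w = e powi n" using pos by (simp add: v_def field_simps)
  thus thesis by (rule that)
qed

section \<open>Real quadratic fields and their integers\<close>

text \<open>Primitive parts are multiplicative, and a monic p is its own primitive part. So p is, up
  to the sign of c, the product of the primitive parts of q and s, and leading coefficients can be
  compared.\<close>

lemma primitive_part_monic_factor:
  fixes p q s :: "int poly"
  assumes "lead_coeff p = 1" "smult c p = q * s" "c \<noteq> 0"
  shows "is_unit (lead_coeff (primitive_part q))"
proof -
  have "Polynomial.content p dvd 1" using content_dvd_coeff[of p "degree p"] assms(1) by simp
  hence "primitive_part p = p" by (intro primitive_part_prim) (simp only: is_unit_content_iff)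
  hence "smult (unit_factor c) p = primitive_part q * primitive_part s"
    using assms(2) by (metis primitive_part_mult primitive_part_smult)
  hence "lead_coeff (primitive_part q) * lead_coeff (primitive_part s) = unit_factor c"
    using assms(1) by (metis lead_coeff_mult lead_coeff_smult mult.right_neutral)
  thus ?thesis using assms(3) by (metis dvd_triv_left dvd_unit_imp_unit unit_factor_is_unit)
qed

lemma map_poly_of_int_add:
  "map_poly of_int (p + q) = (map_poly of_int p + map_poly of_int q :: 'a::comm_ring_1 poly)"
  by (rule poly_eqI) (simp add: coeff_map_poly)

lemma map_poly_of_int_mult:
  "map_poly of_int (p * q) = (map_poly of_int p * map_poly of_int q :: 'a::comm_ring_1 poly)"
  by (rule poly_eqI) (simp add: coeff_map_poly coeff_mult)

text \<open>
  Pseudo-division shows that the primitive quadratic polynomial of \<open>x\<close> divides a multiple of a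
  monic integer polynomial, hence is itself monic by Gauss's lemma.
\<close>

lemma quadratic_algebraic_int:
  fixes x :: real
  assumes "algebraic_int x" "x \<notin> \<rat>" "x\<^sup>2 = u * x + v" "u \<in> \<rat>" "v \<in> \<rat>"
  shows "u \<in> \<int>" "v \<in> \<int>"
proof -
  obtain a1 b1 where u: "b1 > 0" "u = of_int a1 / of_int b1" using Rats_cases'[OF assms(4)] by metis
  obtain a2 b2 where v: "b2 > 0" "v = of_int a2 / of_int b2" using Rats_cases'[OF assms(5)] by metis
  define e a b where "e = b1 * b2" and "a = a1 * b2" and "b = a2 * b1"
  have e: "e > 0" and u': "u = of_int a / of_int e" and v': "v = of_int b / of_int e"
    using u v by (simp_all add: e_def a_def b_def)
  obtain p :: "int poly" where p: "poly (map_poly of_int p) x = 0" "lead_coeff p = 1"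
    using assms(1) by (auto simp: algebraic_int_altdef_ipoly)
  define q where "q = [:-b, -a, e:]"
  have q: "degree q = 2" "lead_coeff q = e" "q \<noteq> 0" using e by (auto simp: q_def)
  have qx: "poly (map_poly of_int q) x = 0"
  proof -
    have "of_int e * x\<^sup>2 = of_int a * x + of_int b"
      using assms(3) e by (simp add: u' v' field_simps)
    thus ?thesis by (simp add: q_def map_poly_pCons algebra_simps power2_eq_square)
  qed
  obtain s r where sr: "pseudo_divmod p q = (s, r)" by fastforce
  obtain k where k: "smult (e ^ k) p = q * s + r" and r: "r = 0 \<or> degree r < 2"
    using pseudo_divmod[OF q(3) sr] q by auto
  \<comment> \<open>A remainder of degree at most 1 that vanishes at the irrational x is
    zero.\<close>
  have "r = 0"
  proof -
    have "degree r \<le> 1" using r by auto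
    then obtain r0 r1 where r_eq: "r = [:r0, r1:]"
      by (metis degree_pCons_eq degree_eq_zeroE Suc_le_mono One_nat_def le_zero_eq pCons_0_0 pCons_cases)
    have "poly (map_poly of_int (smult (e ^ k) p)) x = poly (map_poly of_int (q * s + r)) x"
      using k by simp
    hence "poly (map_poly of_int r) x = 0"
      using p(1) qx by (simp add: map_poly_of_int_add map_poly_of_int_mult map_poly_smult)
    hence eq: "of_int r0 + of_int r1 * x = 0"
      by (simp add: r_eq map_poly_pCons mult.commute)
    have "r1 = 0"
    proof (rule ccontr)
      assume "r1 \<noteq> 0"
      hence "x = - of_int r0 / of_int r1" using eq by (simp add: field_simps)
      also have "\<dots> \<in> \<rat>" by simp
      finally show False using assms(2) by simp
    qed
    thus ?thesis using eq r_eq by simp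
  qed
  hence "is_unit (lead_coeff (primitive_part q))"
    using primitive_part_monic_factor[OF p(2), of "e ^ k" q s] k e by simp
  \<comment> \<open>The leading coefficient e is the content times a unit, so e divides the content
    and with it the numerators a and b.\<close>
  moreover have "Polynomial.content q * lead_coeff (primitive_part q) = e"
    using q(2) by (metis content_times_primitive_part lead_coeff_smult)
  ultimately have "e dvd Polynomial.content q" by (metis mult_unit_dvd_iff dvd_refl)
  hence "e dvd coeff q 0" "e dvd coeff q 1" by (meson content_dvd_coeff dvd_trans)+
  hence "e dvd b" "e dvd a" by (simp_all add: q_def)
  thus "u \<in> \<int>" "v \<in> \<int>" unfolding u' v' using e by (auto elim!: dvdE)
qed

section \<open>Generating the field by a square root\<close>

text \<open>The span of 1 is only the rationals, so dimension 2 forces an irrational t in K. The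
  vectors x, t, 1 cannot be independent inside the span of two vectors, which puts x into the span
  of t and 1.\<close>

lemma rat_dim_two_basis:
  assumes "vector_space.dim (\<lambda>(q::rat) (x::real). of_rat q * x) K = 2" "1 \<in> K"
  obtains t where "t \<in> K" "t \<notin> \<rat>" "\<And>x. x \<in> K \<Longrightarrow> \<exists>a\<in>\<rat>. \<exists>b\<in>\<rat>. x = a + b * t"
proof -
  interpret V: vector_space "\<lambda>(q::rat) (x::real). of_rat q * x"
    by unfold_locales (simp_all add: algebra_simps of_rat_add of_rat_mult)
  obtain B where B: "B \<subseteq> K" "V.independent B" "K \<subseteq> V.span B" "card B = 2"
    using V.basis_exists[of K] assms(1) by metis
  have finB: "finite B" using B(4) by (metis card.infinite zero_neq_numeral)
  have span1: "x \<in> V.span {1} \<longleftrightarrow> x \<in> \<rat>" for x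
    by (auto simp: V.span_singleton Rats_def)
  have "\<not> K \<subseteq> \<rat>"
  proof
    assume "K \<subseteq> \<rat>"
    hence "B \<subseteq> V.span {1}" using B(1) span1 by blast
    hence "card B \<le> card {1::real}" using V.independent_span_bound[of "{1}" B] B(2) by simp
    thus False using B(4) by simp
  qed
  then obtain t where t: "t \<in> K" "t \<notin> \<rat>" by blast
  have ind: "V.independent {t, 1}"
    using t span1 V.independent_empty by (intro V.independent_insertI) auto
  have "\<exists>a\<in>\<rat>. \<exists>b\<in>\<rat>. x = a + b * t" if x: "x \<in> K" for x
  proof -
    have "x \<in> V.span {t, 1}"
    proof (rule ccontr)
      assume nx: "x \<notin> V.span {t, 1}"
      hence "x \<notin> {t, 1}" using V.span_base by blast
      moreover have "t \<noteq> 1" using t(2) by auto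
      ultimately have "card {x, t, 1} = 3" by auto
      moreover have "V.independent {x, t, 1}" using nx ind by (rule V.independent_insertI)
      moreover have "{x, t, 1} \<subseteq> V.span B" using x t assms(2) B(3) by auto
      ultimately show False using V.independent_span_bound[OF finB, of "{x, t, 1}"] B(4) by simp
    qed
    then obtain k where "x - of_rat k * t \<in> \<rat>" by (auto simp: V.span_breakdown_eq[of x t] span1)
    moreover have "x = (x - of_rat k * t) + of_rat k * t" by simp
    ultimately show ?thesis using Rats_of_rat by blast
  qed
  with t show thesis by (rule that)
qed

text \<open>Completing the square in the quadratic equation of an irrational t leaves a rational r
  with a square root in K; a rational square factor then turns r into a squarefree integer.\<close>

lemma real_quadratic_field_sqrt:
  assumes "real_quadratic_field K"
  obtains d :: int where "squarefree d" "d > 0" "sqrt (of_int d) \<notin> \<rat>"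
    "K = {a + b * sqrt (of_int d) | a b. a \<in> \<rat> \<and> b \<in> \<rat>}"
proof -
  have K: "0 \<in> K" "1 \<in> K" and diff: "\<And>x y. x \<in> K \<Longrightarrow> y \<in> K \<Longrightarrow> x - y \<in> K"
    and mult: "\<And>x y. x \<in> K \<Longrightarrow> y \<in> K \<Longrightarrow> x * y \<in> K"
    and inv: "\<And>x. x \<in> K \<Longrightarrow> inverse x \<in> K"
    and dim: "vector_space.dim (\<lambda>(q::rat) (x::real). of_rat q * x) K = 2"
    using assms by (auto simp: real_quadratic_field_def)
  have add: "x + y \<in> K" if "x \<in> K" "y \<in> K" for x y
    using diff[OF that(1) diff[OF K(1) that(2)]] by simp
  have nat: "real n \<in> K" for n using K add by (induction n) auto
  have int: "of_int n \<in> K" for n :: int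
  proof (cases "n \<ge> 0")
    case True
    thus ?thesis using nat[of "nat n"] by simp
  next
    case False
    thus ?thesis using diff[OF K(1) nat[of "nat (- n)"]] by simp
  qed
  have rat: "q \<in> K" if "q \<in> \<rat>" for q
    using that mult[OF int inv[OF int]] by (elim Rats_cases') (simp add: divide_inverse)
  obtain t where t: "t \<in> K" "t \<notin> \<rat>" and rep: "\<And>x. x \<in> K \<Longrightarrow> \<exists>a\<in>\<rat>. \<exists>b\<in>\<rat>. x = a + b * t"
    using rat_dim_two_basis[OF dim K(2)] by blast
  obtain v u where uv: "v \<in> \<rat>" "u \<in> \<rat>" "t * t = v + u * t" using rep[OF mult[OF t(1) t(1)]] by blast
  define r where "r = v + u\<^sup>2 / 4"
  have r_eq: "(t - u / 2)\<^sup>2 = r" using uv(3) by (simp add: r_def power2_eq_square field_simps)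
  have "r \<in> \<rat>" using uv by (simp add: r_def)
  then obtain m n where mn: "n > 0" "r = of_int m / of_int n" by (auto elim: Rats_cases')
  have t_ne: "t - u / 2 \<notin> \<rat>"
  proof
    assume "t - u / 2 \<in> \<rat>"
    hence "t - u / 2 + u / 2 \<in> \<rat>" using uv(2) by (intro Rats_add) auto
    thus False using t(2) by simp
  qed
  hence "t - u / 2 \<noteq> 0" by auto
  hence "r > 0" using r_eq by auto
  hence "m > 0" using mn by (simp add: zero_less_divide_iff)
  \<comment> \<open>\<open>m * n\<close> is the integer n^2 r; stripping its square factor c^2
    changes its root only by the rational factor |c|.\<close>
  define d where "d = squarefree_part (m * n)"
  define c where "c = square_part (m * n)"
  have dc: "m * n = d * c\<^sup>2" unfolding d_def c_def by (rule squarefree_decompose)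
  have mn_pos: "m * n > 0" using mn \<open>m > 0\<close> by simp
  have "c \<noteq> 0" using mn_pos dc by auto
  have "d > 0" using mn_pos dc by (smt (verit) zero_less_mult_iff zero_le_power2)
  have "(of_int n * (t - u / 2))\<^sup>2 = of_int d * (of_int c)\<^sup>2"
  proof -
    have "(of_int n * (t - u / 2))\<^sup>2 = (of_int n)\<^sup>2 * r" by (simp only: power_mult_distrib r_eq)
    also have "\<dots> = of_int (m * n)" using mn by (simp add: power2_eq_square)
    finally show ?thesis unfolding dc by simp
  qed
  hence "\<bar>of_int n * (t - u / 2)\<bar> = sqrt (of_int d * (of_int c)\<^sup>2)"
    by (metis real_sqrt_abs)
  hence "of_int n * \<bar>t - u / 2\<bar> = sqrt (of_int d) * \<bar>of_int c\<bar>"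
    using mn(1) by (simp add: abs_mult real_sqrt_mult)
  \<comment> \<open>The last equation gives t - u / 2 only up to sign, which \<open>sgn\<close>
    restores.\<close>
  define e where "e = sgn (t - u / 2) * \<bar>real_of_int c\<bar> / of_int n"
  have e: "e \<in> \<rat>" "e \<noteq> 0" using \<open>c \<noteq> 0\<close> mn(1) \<open>t - u / 2 \<noteq> 0\<close>
    by (auto simp: e_def sgn_if)
  have t_eq: "t = u / 2 + e * sqrt (of_int d)"
  proof -
    have "\<bar>t - u / 2\<bar> = sqrt (of_int d) * \<bar>of_int c\<bar> / of_int n"
      using \<open>of_int n * \<bar>t - u / 2\<bar> = _\<close> mn(1) by (simp add: field_simps)
    hence "sgn (t - u / 2) * \<bar>t - u / 2\<bar> = e * sqrt (of_int d)" by (simp add: e_def)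
    thus ?thesis by (simp add: sgn_mult_abs)
  qed
  have irr: "sqrt (of_int d) \<notin> \<rat>"
    using t(2) uv(2) e(1) unfolding t_eq by (auto intro!: Rats_add Rats_mult)
  have "sqrt (of_int d) = (t - u / 2) * inverse e" using t_eq e(2) by simp
  moreover have "(t - u / 2) * inverse e \<in> K"
    using uv(2) e(1) by (intro mult diff t(1) rat) auto
  ultimately have sqrtK: "sqrt (of_int d) \<in> K" by simp
  have "K = {a + b * sqrt (of_int d) | a b. a \<in> \<rat> \<and> b \<in> \<rat>}"
  proof (intro subset_antisym subsetI)
    fix x assume "x \<in> K"
    then obtain a b where ab: "a \<in> \<rat>" "b \<in> \<rat>" "x = a + b * t" using rep by blast
    hence "x = (a + b * (u / 2)) + (b * e) * sqrt (of_int d)" by (simp add: t_eq algebra_simps)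
    moreover have "a + b * (u / 2) \<in> \<rat>" "b * e \<in> \<rat>" using ab uv(2) e(1) by auto
    ultimately show "x \<in> {a + b * sqrt (of_int d) | a b. a \<in> \<rat> \<and> b \<in> \<rat>}" by blast
  next
    fix x assume "x \<in> {a + b * sqrt (of_int d) | a b. a \<in> \<rat> \<and> b \<in> \<rat>}"
    thus "x \<in> K" using add mult rat sqrtK by auto
  qed
  thus thesis using that[of d] \<open>d > 0\<close> irr by (auto simp: d_def)
qed

section \<open>Galois conjugation\<close>

lemma sqrt_coeffs_unique:
  assumes "s \<notin> \<rat>" "a + b * s = a' + b' * s" "a \<in> \<rat>" "b \<in> \<rat>" "a' \<in> \<rat>" "b' \<in> \<rat>"
  shows "a = a'" "b = (b'::real)"
proof -
  show "b = b'"
  proof (rule ccontr)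
    assume "b \<noteq> b'"
    hence "s = (a' - a) / (b - b')" using assms(2) by (simp add: field_simps)
    also have "\<dots> \<in> \<rat>" using assms by auto
    finally show False using assms(1) by simp
  qed
  thus "a = a'" using assms(2) by simp
qed

text \<open>Additivity gives \<sigma> 0 = 0, so injectivity excludes \<sigma> 1 = 0 and the
  idempotent \<sigma> 1 must be 1. Sums then reach the integers and products the fractions.\<close>

lemma additive_multiplicative_fixes_Rats:
  fixes \<sigma> :: "real \<Rightarrow> real"
  assumes add: "\<And>x y. x \<in> K \<Longrightarrow> y \<in> K \<Longrightarrow> \<sigma> (x + y) = \<sigma> x + \<sigma> y"
    and mult: "\<And>x y. x \<in> K \<Longrightarrow> y \<in> K \<Longrightarrow> \<sigma> (x * y) = \<sigma> x * \<sigma> y"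
    and "\<rat> \<subseteq> K" "inj_on \<sigma> K" "q \<in> \<rat>"
  shows "\<sigma> q = q"
proof -
  have K: "x \<in> K" if "x \<in> \<rat>" for x using that assms(3) by auto
  have \<sigma>0: "\<sigma> 0 = 0" using add[of 0 0] K by simp
  have "\<sigma> 1 \<noteq> 0" using \<sigma>0 K assms(4) by (metis Rats_0 Rats_1 inj_onD zero_neq_one)
  hence \<sigma>1: "\<sigma> 1 = 1" using mult[of 1 1] K by simp
  have nat: "\<sigma> (real n) = real n" for n by (induction n) (auto simp: \<sigma>0 \<sigma>1 add K)
  have int: "\<sigma> (of_int n) = of_int n" for n :: int
  proof (cases "n \<ge> 0")
    case True
    thus ?thesis using nat[of "nat n"] by simp
  next
    case False
    have "\<sigma> (of_int n + real (nat (- n))) = \<sigma> (of_int n) + real (nat (- n))"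
      using nat by (subst add) (auto intro: K)
    thus ?thesis using False \<sigma>0 by simp
  qed
  obtain m n where mn: "n > 0" "q = of_int m / of_int n" using assms(5) by (auto elim: Rats_cases')
  have "\<sigma> (q * of_int n) = \<sigma> q * of_int n" using mult K assms(5) int by simp
  moreover have "q * of_int n = of_int m" using mn by simp
  ultimately have "\<sigma> q * of_int n = q * of_int n" using int by metis
  thus ?thesis using mn(1) by simp
qed

text \<open>The definite description needs one candidate and no other. An automorphism fixes the
  rationals and sends sqrt d to a root of X^2 - d; the root sqrt d would give the identity on K, so
  only -sqrt d remains.\<close>

lemma quad_conj_eq:
  assumes irr: "sqrt (of_int d) \<notin> \<rat>" and d: "d > 0"
    and K: "K = {a + b * sqrt (of_int d) | a b. a \<in> \<rat> \<and> b \<in> \<rat>}"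
    and ab: "a \<in> \<rat>" "b \<in> \<rat>"
  shows "quad_conj K (a + b * sqrt (of_int d)) = a - b * sqrt (of_int d)"
proof -
  let ?s = "sqrt (of_int d)"
  let ?P = "\<lambda>\<sigma>. bij_betw \<sigma> K K \<and>
     (\<forall>x\<in>K. \<forall>y\<in>K. \<sigma> (x + y) = \<sigma> x + \<sigma> y \<and> \<sigma> (x * y) = \<sigma> x * \<sigma> y) \<and>
     (\<exists>x\<in>K. \<sigma> x \<noteq> x) \<and> (\<forall>x. x \<notin> K \<longrightarrow> \<sigma> x = x)"
  \<comment> \<open>Conjugation in coordinates. Their uniqueness makes the inner \<open>THE\<close>
    well defined, and the value outside K follows the convention of
    \<open>quad_conj\<close>.\<close>
  define c where "c = (\<lambda>x. if x \<in> K
    then (THE y. \<exists>a\<in>\<rat>. \<exists>b\<in>\<rat>. x = a + b * ?s \<and> y = a - b * ?s) else x)"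
  have memK: "a + b * ?s \<in> K" if "a \<in> \<rat>" "b \<in> \<rat>" for a b using that K by blast
  have memK': "a - b * ?s \<in> K" if "a \<in> \<rat>" "b \<in> \<rat>" for a b
    using memK[of a "- b"] that by simp
  have c: "c (a + b * ?s) = a - b * ?s" if "a \<in> \<rat>" "b \<in> \<rat>" for a b
  proof -
    have "(THE y. \<exists>a'\<in>\<rat>. \<exists>b'\<in>\<rat>. a + b * ?s = a' + b' * ?s \<and> y = a' - b' * ?s) = a - b * ?s"
      using that sqrt_coeffs_unique[OF irr, of a b] by (intro the_equality) blast+
    thus ?thesis using memK[OF that] by (simp add: c_def)
  qed
  have c': "c (a - b * ?s) = a + b * ?s" if "a \<in> \<rat>" "b \<in> \<rat>" for a b
    using c[of a "- b"] that by simp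
  have "?P c"
  proof (intro conjI ballI)
    have "c x \<in> K \<and> c (c x) = x" if x: "x \<in> K" for x
    proof -
      obtain a b where "x = a + b * ?s" "a \<in> \<rat>" "b \<in> \<rat>" using x K by blast
      thus ?thesis using c c' memK' by simp
    qed
    thus "bij_betw c K K" by (intro bij_betw_byWitness[where f' = c]) auto
    fix x y assume "x \<in> K" "y \<in> K"
    then obtain a b a' b' where x: "x = a + b * ?s" "a \<in> \<rat>" "b \<in> \<rat>"
      and y: "y = a' + b' * ?s" "a' \<in> \<rat>" "b' \<in> \<rat>" unfolding K by blast
    have cx: "c x = a - b * ?s" and cy: "c y = a' - b' * ?s" using c x y by simp_all
    have "x + y = (a + a') + (b + b') * ?s" by (simp add: x y algebra_simps)
    hence "c (x + y) = (a + a') - (b + b') * ?s"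
      using c[of "a + a'" "b + b'"] x(2,3) y(2,3) by simp
    thus "c (x + y) = c x + c y" by (simp add: cx cy algebra_simps)
    have "x * y = (a * a' + b * b' * of_int d) + (a * b' + b * a') * ?s"
      using d by (simp add: x y algebra_simps)
    hence "c (x * y) = (a * a' + b * b' * of_int d) - (a * b' + b * a') * ?s"
      using c[of "a * a' + b * b' * of_int d" "a * b' + b * a'"] x(2,3) y(2,3) by simp
    thus "c (x * y) = c x * c y" using d by (simp add: cx cy algebra_simps)
  next
    have "?s \<in> K" "c ?s = - ?s" using memK[of 0 1] c[of 0 1] by auto
    thus "\<exists>x\<in>K. c x \<noteq> x" using d by (intro bexI[of _ ?s]) auto
  qed (simp add: c_def)
  moreover have "\<sigma> = c" if "?P \<sigma>" for \<sigma>
  proof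
    fix x
    from that have bij: "bij_betw \<sigma> K K"
      and add: "\<And>x y. x \<in> K \<Longrightarrow> y \<in> K \<Longrightarrow> \<sigma> (x + y) = \<sigma> x + \<sigma> y"
      and mult: "\<And>x y. x \<in> K \<Longrightarrow> y \<in> K \<Longrightarrow> \<sigma> (x * y) = \<sigma> x * \<sigma> y"
      and nontriv: "\<exists>x\<in>K. \<sigma> x \<noteq> x" and outside: "\<And>x. x \<notin> K \<Longrightarrow> \<sigma> x = x" by blast+
    have RK: "\<rat> \<subseteq> K" using memK[of _ 0] by auto
    have sK: "?s \<in> K" using memK[of 0 1] by simp
    have fixQ: "\<sigma> q = q" if "q \<in> \<rat>" for q
      using additive_multiplicative_fixes_Rats[OF add mult RK bij_betw_imp_inj_on[OF bij] that] .
    have lin: "\<sigma> (a + b * ?s) = a + b * \<sigma> ?s" if ab: "a \<in> \<rat>" "b \<in> \<rat>" for a b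
    proof -
      have "b * ?s \<in> K" using memK[of 0 b] ab by simp
      moreover have "a \<in> K" "b \<in> K" using ab RK by auto
      ultimately show ?thesis using add[of a "b * ?s"] mult[of b ?s] ab sK fixQ by simp
    qed
    have "\<sigma> ?s * \<sigma> ?s = of_int d" using mult[OF sK sK] fixQ d by simp
    hence "\<sigma> ?s * \<sigma> ?s = ?s * ?s" using d by simp
    hence "\<sigma> ?s = ?s \<or> \<sigma> ?s = - ?s" by (rule square_eq_iff[THEN iffD1])
    moreover have "\<sigma> ?s \<noteq> ?s"
    proof
      assume "\<sigma> ?s = ?s"
      hence "\<sigma> x = x" if "x \<in> K" for x using that lin by (auto simp: K)
      thus False using nontriv by blast
    qed
    ultimately have "\<sigma> ?s = - ?s" by blast
    show "\<sigma> x = c x"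
    proof (cases "x \<in> K")
      case True
      then obtain a b where "x = a + b * ?s" "a \<in> \<rat>" "b \<in> \<rat>" unfolding K by blast
      thus ?thesis using lin c \<open>\<sigma> ?s = - ?s\<close> by simp
    next
      case False
      thus ?thesis using outside by (simp add: c_def)
    qed
  qed
  ultimately have "quad_conj K = c" unfolding quad_conj_def by (rule the_equality)
  thus ?thesis using c ab by simp
qed

section \<open>The ring of integers\<close>

text \<open>For q = m / n in lowest terms, n^2 divides d m^2 and is coprime to m^2, so it divides
  the squarefree d.\<close>

lemma squarefree_mult_square_in_Ints:
  fixes d :: int and q :: real
  assumes "squarefree d" "q \<in> \<rat>" "of_int d * q\<^sup>2 \<in> \<int>"
  shows "q \<in> \<int>"
proof -
  obtain m n where mn: "n > 0" "coprime m n" "q = of_int m / of_int n"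
    using assms(2) by (auto elim: Rats_cases')
  obtain k where "of_int d * q\<^sup>2 = of_int k" using assms(3) by (elim Ints_cases)
  hence "real_of_int (d * m\<^sup>2) = real_of_int (k * n\<^sup>2)"
    using mn by (simp add: power_divide field_simps)
  hence "d * m\<^sup>2 = k * n\<^sup>2" unfolding of_int_eq_iff .
  hence "n\<^sup>2 dvd d * m\<^sup>2" by simp
  moreover have "coprime (n\<^sup>2) (m\<^sup>2)" using mn(2) by (simp add: coprime_commute)
  ultimately have "n\<^sup>2 dvd d" by (simp add: coprime_dvd_mult_left_iff)
  hence "n dvd 1" using assms(1) by (rule squarefreeD[rotated])
  thus ?thesis using mn by simp
qed

text \<open>A square is 0 or 1 modulo 4 according to parity, so s^2 = d t^2 modulo 4 becomes a
  finite check for d = 1, 2, 3 modulo 4.\<close>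

lemma four_dvd_diff_squares:
  fixes s t d :: int
  assumes "4 dvd s\<^sup>2 - d * t\<^sup>2" "\<not> 4 dvd d"
  shows "d mod 4 = 1 \<Longrightarrow> even (s - t)" and "d mod 4 \<noteq> 1 \<Longrightarrow> even s \<and> even t"
proof -
  have sq: "x\<^sup>2 mod 4 = (if even x then 0 else 1)" for x :: int
  proof (cases "even x")
    case True
    then obtain y where "x = 2 * y" by (elim evenE)
    thus ?thesis by (simp add: power_mult_distrib)
  next
    case False
    then obtain y where "x = 2 * y + 1" by (elim oddE)
    hence "x\<^sup>2 = 4 * (y\<^sup>2 + y) + 1" by (simp add: power2_eq_square algebra_simps)
    thus ?thesis using False by presburger
  qed
  have eq: "s\<^sup>2 mod 4 = d mod 4 * (t\<^sup>2 mod 4) mod 4"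
    using assms(1) by (simp add: mod_eq_dvd_iff mod_mult_eq)
  have d: "d mod 4 \<noteq> 0" "d mod 4 \<ge> 0" "d mod 4 < 4" using assms(2) by (auto simp: dvd_eq_mod_eq_0)
  show "even (s - t)" if "d mod 4 = 1" using eq that by (auto simp: sq split: if_splits)
  show "even s \<and> even t" if "d mod 4 \<noteq> 1" using eq that d by (auto simp: sq split: if_splits)
qed

text \<open>For x = (s + t sqrt d) / 2, integrality of trace and norm makes s and t integers with 4
  dividing s^2 - d t^2, and parity does the rest. Conversely, each listed element is a root of its
  characteristic polynomial. The generator (D + sqrt D) / 2 covers both cases of d modulo 4.\<close>

lemma ring_of_integers_sqrt:
  assumes d: "squarefree d" "d > 0" and irr: "sqrt (of_int d) \<notin> \<rat>"
    and K: "K = {a + b * sqrt (of_int d) | a b. a \<in> \<rat> \<and> b \<in> \<rat>}"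
    and D: "D = (if d mod 4 = 1 then d else 4 * d)"
  shows "ring_of_integers K =
    {of_int m + of_int n * ((of_int D + sqrt (of_int D)) / 2) | m n :: int. True}"
proof (intro subset_antisym subsetI)
  let ?s = "sqrt (of_int d)"
  have sqrt_D: "sqrt (of_int D) = (if d mod 4 = 1 then 1 else 2) * ?s"
    using D by (simp add: real_sqrt_mult)
  {
    fix x assume "x \<in> ring_of_integers K"
    then obtain a b where x: "x = a + b * ?s" and ab: "a \<in> \<rat>" "b \<in> \<rat>" and "algebraic_int x"
      by (auto simp: ring_of_integers_def K)
    show "x \<in> {of_int m + of_int n * ((of_int D + sqrt (of_int D)) / 2) | m n :: int. True}"
    proof (cases "b = 0")
      case True
      hence "x \<in> \<int>" using \<open>algebraic_int x\<close> ab x rational_algebraic_int_is_int by simp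
      then obtain m where "x = of_int m" by (elim Ints_cases)
      hence "x = of_int m + of_int 0 * ((of_int D + sqrt (of_int D)) / 2)" by simp
      thus ?thesis by blast
    next
      case False
      have "x \<notin> \<rat>"
      proof
        assume "x \<in> \<rat>"
        hence "(x - a) / b \<in> \<rat>" using ab by auto
        thus False using x False irr by simp
      qed
      moreover have "x\<^sup>2 = (2 * a) * x + (of_int d * b\<^sup>2 - a\<^sup>2)"
        using d(2) by (simp add: x power2_eq_square algebra_simps)
      ultimately have "2 * a \<in> \<int>" "of_int d * b\<^sup>2 - a\<^sup>2 \<in> \<int>"
        using quadratic_algebraic_int[OF \<open>algebraic_int x\<close>, of "2 * a" "of_int d * b\<^sup>2 - a\<^sup>2"] ab
        by simp_all
      then obtain s N where s: "2 * a = of_int s" and N: "of_int d * b\<^sup>2 - a\<^sup>2 = of_int N"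
        by (elim Ints_cases)
      have "of_int d * (2 * b)\<^sup>2 = 4 * (of_int d * b\<^sup>2 - a\<^sup>2) + (2 * a)\<^sup>2"
        by (simp add: power_mult_distrib)
      also have "\<dots> = of_int (4 * N + s\<^sup>2)" unfolding s N by simp
      finally have dN: "of_int d * (2 * b)\<^sup>2 = real_of_int (4 * N + s\<^sup>2)" .
      have "2 * b \<in> \<rat>" using ab by simp
      moreover have "of_int d * (2 * b)\<^sup>2 \<in> \<int>" unfolding dN by (rule Ints_of_int)
      ultimately have "2 * b \<in> \<int>" by (rule squarefree_mult_square_in_Ints[OF d(1)])
      then obtain t where t: "2 * b = of_int t" by (elim Ints_cases)
      have "real_of_int (d * t\<^sup>2) = real_of_int (4 * N + s\<^sup>2)" using dN unfolding t by simp
      hence "d * t\<^sup>2 = 4 * N + s\<^sup>2" unfolding of_int_eq_iff .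
      hence dvd: "4 dvd s\<^sup>2 - d * t\<^sup>2" by simp
      have not4: "\<not> 4 dvd d" using squarefreeD[OF d(1), of 2] by auto
      have x': "x = (of_int s + of_int t * ?s) / 2" using s t x by (simp add: field_simps)
      show ?thesis
      proof (cases "d mod 4 = 1")
        case True
        hence "odd d" by presburger
        hence "even (s - t * d)" using four_dvd_diff_squares(1)[OF dvd not4 True] by auto
        then obtain m where "s - t * d = 2 * m" by (elim evenE)
        hence "s = 2 * m + t * d" by simp
        hence "x = of_int m + of_int t * ((of_int D + sqrt (of_int D)) / 2)"
          using True by (simp add: x' D field_simps)
        thus ?thesis by blast
      next
        case False
        then obtain s' t' where st: "s = 2 * s'" "t = 2 * t'"
          using four_dvd_diff_squares(2)[OF dvd not4 False] by (auto elim!: evenE)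
        \<comment> \<open>Here D = 4 d, so t' times the generator is 2 t' d + t' sqrt d; the integer
          coefficient compensates for 2 t' d.\<close>
        have "x = of_int (s' - 2 * t' * d) + of_int t' * ((of_int D + sqrt (of_int D)) / 2)"
          unfolding sqrt_D using False by (simp add: x' D st field_simps)
        thus ?thesis by blast
      qed
    qed
  next
    fix x assume "x \<in> {of_int m + of_int n * ((of_int D + sqrt (of_int D)) / 2) | m n :: int. True}"
    then obtain m n :: int where x: "x = of_int m + of_int n * ((of_int D + sqrt (of_int D)) / 2)"
      by blast
    have "x = (of_int m + of_int n * of_int D / 2) +
        (of_int n * (if d mod 4 = 1 then 1 else 2) / 2) * ?s"
      unfolding x sqrt_D by (simp add: field_simps)
    moreover have "of_int m + of_int n * of_int D / 2 \<in> (\<rat> :: real set)"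
      "of_int n * (if d mod 4 = 1 then 1 else 2) / 2 \<in> (\<rat> :: real set)" by auto
    ultimately have "x \<in> K" unfolding K by blast
    moreover have "algebraic_int x"
    proof -
      \<comment> \<open>The generator has norm D (D - 1) / 4, which is thereby an integer e.\<close>
      have "4 dvd D * (D - 1)"
      proof (cases "d mod 4 = 1")
        case True
        hence "4 dvd D - 1" using D by presburger
        thus ?thesis by simp
      qed (simp add: D)
      then obtain e where e: "D * (D - 1) = 4 * e" by (elim dvdE)
      \<comment> \<open>The characteristic polynomial of x: its trace is 2 m + n D and its norm is
        m^2 + m n D + n^2 e.\<close>
      define p :: "int poly" where "p = [:m\<^sup>2 + m * n * D + n\<^sup>2 * e, - (2 * m + n * D), 1:]"
      have e': "real_of_int D * (of_int D - 1) = 4 * of_int e"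
        using arg_cong[OF e, of real_of_int] by simp
      have "D > 0" using D d by simp
      hence sq: "sqrt (real_of_int D) * sqrt (of_int D) = of_int D" by simp
      have "poly (map_poly of_int p) x = of_int n ^ 2 *
          (4 * of_int e - of_int D * of_int D + sqrt (of_int D) * sqrt (of_int D)) / 4"
        by (simp add: p_def map_poly_pCons x power2_eq_square field_simps)
      also have "\<dots> = 0" unfolding sq using e' by (simp add: algebra_simps)
      finally have "poly (map_poly of_int p) x = 0" .
      moreover have "lead_coeff p = 1" by (simp add: p_def)
      ultimately show ?thesis by (auto simp: algebraic_int_altdef_ipoly)
    qed
    ultimately show "x \<in> ring_of_integers K" by (simp add: ring_of_integers_def)
  }
qed

section \<open>Units and conductors\<close>

text \<open>Isolates what the unit theory uses about K, stated through D alone. That D is the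
  discriminant is a consequence, \<open>disc_eq\<close>.\<close>

locale quadratic_field_disc =
  fixes K :: "real set" and D :: int
  assumes sqrt_irrational: "sqrt (of_int D) \<notin> \<rat>" and D_pos: "D > 0"
    and ring_of_integers_eq:
      "ring_of_integers K = {of_int m + of_int n * ((of_int D + sqrt (of_int D)) / 2) | m n :: int. True}"
    and conj_eq: "\<And>a b. a \<in> \<rat> \<Longrightarrow> b \<in> \<rat> \<Longrightarrow>
      quad_conj K (a + b * sqrt (of_int D)) = a - b * sqrt (of_int D)"
begin

lemma sqrt_D_pos: "sqrt (of_int D) > 0"
  using D_pos by simp

abbreviation omega :: real where
  "omega \<equiv> (of_int D + sqrt (of_int D)) / 2"

lemma omega_coeffs_unique:
  fixes m n m' n' :: int
  assumes "of_int m + of_int n * omega = of_int m' + of_int n' * omega"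
  shows "m = m'" "n = n'"
proof -
  have "(of_int m + of_int n * of_int D / 2) + of_int n / 2 * sqrt (of_int D) =
      (of_int m' + of_int n' * of_int D / 2) + of_int n' / 2 * sqrt (of_int D)"
    using assms by (simp add: field_simps)
  from sqrt_coeffs_unique(2)[OF sqrt_irrational this] have "real_of_int n = of_int n'" by simp
  thus "n = n'" by simp
  with assms show "m = m'" by simp
qed

lemma conj_omega:
  fixes m n :: int
  shows "quad_conj K (of_int m + of_int n * omega) = of_int m + of_int n * (omega - sqrt (of_int D))"
proof -
  have "quad_conj K ((of_int m + of_int n * of_int D / 2) + of_int n / 2 * sqrt (of_int D)) =
      (of_int m + of_int n * of_int D / 2) - of_int n / 2 * sqrt (of_int D)"
    by (rule conj_eq) auto
  moreover have "(of_int m + of_int n * of_int D / 2) + of_int n / 2 * sqrt (of_int D) =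
      of_int m + of_int n * omega" by (simp add: field_simps)
  ultimately show ?thesis by (simp add: field_simps)
qed

text \<open>The basis 1, \<open>omega\<close> yields D. Any other integral basis arises from it by
  an integer matrix invertible over the integers, whose determinant has square 1, so the value is
  unique.\<close>

lemma disc_eq: "quad_disc K = D"
  unfolding quad_disc_def
proof (rule the_equality)
  have "integral_basis K 1 omega"
    unfolding integral_basis_def bij_betw_def
  proof
    show "inj (\<lambda>(m::int, n::int). of_int m * 1 + of_int n * omega)"
      using omega_coeffs_unique by (auto intro!: injI)
    show "range (\<lambda>(m::int, n::int). of_int m * 1 + of_int n * omega) = ring_of_integers K"
      by (auto simp: ring_of_integers_eq)
  qed
  moreover have "1 * quad_conj K omega - omega * quad_conj K 1 = - sqrt (of_int D)"
    using conj_omega[of 0 1] conj_omega[of 1 0] by (simp add: field_simps)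
  hence "of_int D = (1 * quad_conj K omega - omega * quad_conj K 1)\<^sup>2"
    using D_pos by simp
  ultimately show "\<exists>\<alpha> \<beta>. integral_basis K \<alpha> \<beta> \<and>
      of_int D = (\<alpha> * quad_conj K \<beta> - \<beta> * quad_conj K \<alpha>)\<^sup>2" by blast
next
  fix D' assume "\<exists>\<alpha> \<beta>. integral_basis K \<alpha> \<beta> \<and>
      of_int D' = (\<alpha> * quad_conj K \<beta> - \<beta> * quad_conj K \<alpha>)\<^sup>2"
  then obtain \<alpha> \<beta> where basis: "integral_basis K \<alpha> \<beta>"
    and D': "of_int D' = (\<alpha> * quad_conj K \<beta> - \<beta> * quad_conj K \<alpha>)\<^sup>2" by blast
  have img: "(\<lambda>(m::int, n::int). of_int m * \<alpha> + of_int n * \<beta>) ` UNIV = ring_of_integers K"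
    using basis by (simp add: integral_basis_def bij_betw_def)
  have in_ring: "of_int m * \<alpha> + of_int n * \<beta> \<in> ring_of_integers K" for m n :: int
    using img by (force simp flip: img)
  have repr: "\<exists>m n :: int. x = of_int m * \<alpha> + of_int n * \<beta>" if "x \<in> ring_of_integers K" for x
    using that unfolding img[symmetric] by auto
  obtain p q :: int where \<alpha>: "\<alpha> = of_int p + of_int q * omega"
    using in_ring[of 1 0] by (auto simp: ring_of_integers_eq)
  obtain r s :: int where \<beta>: "\<beta> = of_int r + of_int s * omega"
    using in_ring[of 0 1] by (auto simp: ring_of_integers_eq)
  have one: "of_int 1 + of_int 0 * omega \<in> ring_of_integers K"
    and om: "of_int 0 + of_int 1 * omega \<in> ring_of_integers K"
    unfolding ring_of_integers_eq by blast+
  obtain t u :: int where "of_int 1 + of_int 0 * omega = of_int t * \<alpha> + of_int u * \<beta>"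
    using repr[OF one] by blast
  hence "of_int 1 + of_int 0 * omega = of_int (t * p + u * r) + of_int (t * q + u * s) * omega"
    unfolding \<alpha> \<beta> by (simp add: field_simps)
  note tu = omega_coeffs_unique[OF this]
  obtain v w :: int where "of_int 0 + of_int 1 * omega = of_int v * \<alpha> + of_int w * \<beta>"
    using repr[OF om] by blast
  hence "of_int 0 + of_int 1 * omega = of_int (v * p + w * r) + of_int (v * q + w * s) * omega"
    unfolding \<alpha> \<beta> by (simp add: field_simps)
  note vw = omega_coeffs_unique[OF this]
  \<comment> \<open>Multiplicativity of determinants: the matrix expressing 1, \<open>omega\<close>
    through \<alpha>, \<beta> is inverse to the one expressing \<alpha>, \<beta> through 1,
    \<open>omega\<close>.\<close>
  have "(t * w - u * v) * (p * s - q * r) =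
      (t * p + u * r) * (v * q + w * s) - (t * q + u * s) * (v * p + w * r)"
    by (simp add: algebra_simps)
  also have "\<dots> = 1" by (simp flip: tu vw)
  finally have "\<bar>p * s - q * r\<bar> = 1" by (metis abs_zmult_eq_1 mult.commute abs_one)
  hence det: "(p * s - q * r)\<^sup>2 = 1" by (metis power2_abs one_power2)
  have "\<alpha> * quad_conj K \<beta> - \<beta> * quad_conj K \<alpha> = - of_int (p * s - q * r) * sqrt (of_int D)"
    unfolding \<alpha> \<beta> conj_omega by (simp add: field_simps)
  hence "real_of_int D' = of_int ((p * s - q * r)\<^sup>2) * of_int D"
    using D' D_pos by (simp add: power_mult_distrib power2_commute)
  thus "D' = D" unfolding det by simp
qed

section \<open>Norm-one elements of the orders\<close>

lemma norm_half_eq: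
  fixes x y :: int
  shows "quad_norm K ((of_int x + of_int y * sqrt (of_int D)) / 2) = of_int (x\<^sup>2 - D * y\<^sup>2) / 4"
proof -
  have "quad_norm K (of_int x / 2 + of_int y / 2 * sqrt (of_int D)) = of_int (x\<^sup>2 - D * y\<^sup>2) / 4"
    unfolding quad_norm_def using D_pos
    by (subst conj_eq) (auto simp: field_simps power2_eq_square)
  thus ?thesis by (simp add: add_divide_distrib)
qed

lemma norm_one_units_eq:
  assumes "f > 0"
  shows "norm_one_units K f = pell_units (D * (int f)\<^sup>2)"
proof -
  have sqrt_eq: "sqrt (of_int (D * (int f)\<^sup>2)) = of_nat f * sqrt (of_int D)"
    by (simp add: real_sqrt_mult)
  show ?thesis
  proof (intro subset_antisym subsetI)
    fix w assume w: "w \<in> norm_one_units K f"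
    then obtain m n :: int where
      "w = of_int m + of_int n * of_nat f * ((of_int D + sqrt (of_int D)) / 2)"
      by (auto simp: norm_one_units_def order_of_conductor_def disc_eq)
    hence w_eq: "w = (of_int (2 * m + n * int f * D) + of_int (n * int f) * sqrt (of_int D)) / 2"
      by (simp add: field_simps)
    have "quad_norm K w = 1" using w by (simp add: norm_one_units_def)
    hence "real_of_int ((2 * m + n * int f * D)\<^sup>2 - D * (n * int f)\<^sup>2) = real_of_int 4"
      unfolding w_eq norm_half_eq by simp
    hence "(2 * m + n * int f * D)\<^sup>2 - D * (int f)\<^sup>2 * n\<^sup>2 = 4"
      unfolding of_int_eq_iff by (simp add: power_mult_distrib mult_ac)
    thus "w \<in> pell_units (D * (int f)\<^sup>2)"
      by (rule pell_unitsI) (use w_eq sqrt_eq in simp)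
  next
    fix w assume "w \<in> pell_units (D * (int f)\<^sup>2)"
    then obtain x y :: int where xy: "x\<^sup>2 - D * (int f)\<^sup>2 * y\<^sup>2 = 4"
      and w: "w = (of_int x + of_int y * sqrt (of_int (D * (int f)\<^sup>2))) / 2"
      by (auto simp: pell_units_def)
    have w': "w = (of_int x + of_int (y * int f) * sqrt (of_int D)) / 2"
      unfolding w sqrt_eq by simp
    \<comment> \<open>Modulo 2 a number equals its square, so the norm equation gives x = y f D
      modulo 2. This is the congruence for membership in the order and supplies the coefficient
      m.\<close>
    have "even (x\<^sup>2 - D * (int f)\<^sup>2 * y\<^sup>2)" using xy by simp
    hence "even (x - y * int f * D)" by auto
    then obtain m where "x - y * int f * D = 2 * m" by (elim evenE)
    hence x: "x = 2 * m + y * int f * D" by simp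
    have "w = of_int m + of_int y * of_nat f * ((of_int D + sqrt (of_int D)) / 2)"
      unfolding w' x by (simp add: field_simps)
    hence "w \<in> order_of_conductor K f" by (auto simp: order_of_conductor_def disc_eq)
    moreover have "x\<^sup>2 - D * (y * int f)\<^sup>2 = 4" using xy by (simp add: power_mult_distrib mult_ac)
    hence "quad_norm K w = 1" unfolding w' norm_half_eq by simp
    ultimately show "w \<in> norm_one_units K f" by (simp add: norm_one_units_def)
  qed
qed

lemma order_of_conductor_one: "order_of_conductor K 1 = ring_of_integers K"
  by (simp add: order_of_conductor_def ring_of_integers_eq disc_eq)

text \<open>An integer of norm 1 is a unit, since its inverse is again an integer of norm 1. This
  brings the set in the definition of \<open>eps\<close> into Pell form.\<close>

lemma norm_one_unit_of_field_iff: "unit_of_field K w \<and> quad_norm K w = 1 \<longleftrightarrow> w \<in> pell_units D"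
proof -
  have norm_iff: "w \<in> ring_of_integers K \<and> quad_norm K w = 1 \<longleftrightarrow> w \<in> pell_units D" for w
    using norm_one_units_eq[of 1] order_of_conductor_one by (auto simp: norm_one_units_def)
  have "\<exists>v\<in>ring_of_integers K. w * v = 1" if "w \<in> pell_units D"
  proof
    show "inverse w \<in> ring_of_integers K"
      using norm_iff pell_units_inverse_closed[OF that D_pos] by blast
    show "w * inverse w = 1" using pell_units_nonzero[OF that D_pos] by simp
  qed
  thus ?thesis using norm_iff[of w] by (auto simp: unit_of_field_def)
qed

section \<open>The fundamental unit and its sequence\<close>

text \<open>\<open>LEAST\<close> over the reals has its intended meaning only when the minimum is
  attained; the least Pell unit above 1 provides it.\<close>

lemma eps_least:
  shows eps_pell_unit: "eps K \<in> pell_units D" and eps_gt_1: "eps K > 1"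
    and eps_le: "\<And>v. v \<in> pell_units D \<Longrightarrow> v > 1 \<Longrightarrow> eps K \<le> v"
proof -
  obtain w where w: "w \<in> pell_units D" "w > 1" "\<And>v. v \<in> pell_units D \<Longrightarrow> v > 1 \<Longrightarrow> w \<le> v"
    using pell_units_least_exists[OF sqrt_irrational D_pos] by blast
  have "eps K = w"
    unfolding eps_def using w norm_one_unit_of_field_iff by (intro Least_equality) blast+
  thus "eps K \<in> pell_units D" "eps K > 1" "\<And>v. v \<in> pell_units D \<Longrightarrow> v > 1 \<Longrightarrow> eps K \<le> v"
    using w by auto
qed

lemma eps_power_pell_unit: "eps K ^ j \<in> pell_units D"
  using pell_units_power eps_pell_unit D_pos by blast

text \<open>Justifies the \<open>THE\<close> in \<open>fseq\<close>: the difference is an integer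
  multiple of sqrt D because the power is a Pell unit, and the integer is nonnegative because the
  power is at least 1.\<close>

lemma fseq_mult_sqrt: "real (fseq K j) * sqrt (of_int D) = eps K ^ j - inverse (eps K ^ j)"
proof -
  obtain y :: int where y: "eps K ^ j - inverse (eps K ^ j) = of_int y * sqrt (of_int D)"
    by (rule pell_unitsE[OF eps_power_pell_unit D_pos]) blast
  have "eps K ^ j \<ge> 1" using eps_gt_1 by simp
  hence "inverse (eps K ^ j) \<le> 1" by (simp add: inverse_le_1_iff)
  hence "of_int y * sqrt (of_int D) \<ge> 0" using y \<open>eps K ^ j \<ge> 1\<close> by linarith
  hence "y \<ge> 0" using sqrt_D_pos by (simp add: zero_le_mult_iff)
  then obtain n where n: "y = int n" using zero_le_imp_eq_int by blast
  have "(eps K ^ j - inverse (eps K ^ j)) / sqrt (of_int D) = real n"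
    unfolding y n using sqrt_D_pos by simp
  hence "fseq K j = n" unfolding fseq_def disc_eq by simp
  thus ?thesis using y n by simp
qed

lemma fseq_strict_mono: "strict_mono (fseq K)"
proof (rule strict_monoI)
  fix i j :: nat assume "i < j"
  hence less: "eps K ^ i < eps K ^ j" using eps_gt_1 by simp
  moreover have "eps K ^ i > 0" using eps_gt_1 by simp
  ultimately have "inverse (eps K ^ j) < inverse (eps K ^ i)" by (intro less_imp_inverse_less)
  hence "real (fseq K i) * sqrt (of_int D) < real (fseq K j) * sqrt (of_int D)"
    unfolding fseq_mult_sqrt using less by linarith
  thus "fseq K i < fseq K j" using sqrt_D_pos by simp
qed

lemma fseq_pos: "k > 0 \<Longrightarrow> fseq K k > 0"
  using fseq_strict_mono by (metis strict_mono_less less_nat_zero_code neq0_conv)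

section \<open>Conductors and exponents\<close>

lemma conductor_disc:
  assumes "f > 0"
  shows "D * (int f)\<^sup>2 > 0" "sqrt (of_int (D * (int f)\<^sup>2)) = of_nat f * sqrt (of_int D)"
    "sqrt (of_int (D * (int f)\<^sup>2)) \<notin> \<rat>"
proof -
  show "D * (int f)\<^sup>2 > 0" using assms D_pos by simp
  show *: "sqrt (of_int (D * (int f)\<^sup>2)) = of_nat f * sqrt (of_int D)"
    by (simp add: real_sqrt_mult)
  show "sqrt (of_int (D * (int f)\<^sup>2)) \<notin> \<rat>"
  proof
    assume "sqrt (of_int (D * (int f)\<^sup>2)) \<in> \<rat>"
    hence "real f * sqrt (of_int D) / real f \<in> \<rat>" unfolding * by (intro Rats_divide) auto
    thus False using assms sqrt_irrational by simp
  qed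
qed

text \<open>The sqrt D coordinate of the power, in halves, is \<open>fseq K j\<close>. As sqrt (D
  f^2) = f sqrt D, membership for conductor f asks exactly that f divide this coordinate.\<close>

lemma dvd_fseq_iff:
  assumes "f > 0"
  shows "f dvd fseq K j \<longleftrightarrow> eps K ^ j \<in> pell_units (D * (int f)\<^sup>2)"
proof
  assume "f dvd fseq K j"
  then obtain y where y: "fseq K j = f * y" by (elim dvdE)
  obtain x z where xz: "x\<^sup>2 - D * z\<^sup>2 = 4" "eps K ^ j = (of_int x + of_int z * sqrt (of_int D)) / 2"
    "eps K ^ j - inverse (eps K ^ j) = of_int z * sqrt (of_int D)"
    by (rule pell_unitsE[OF eps_power_pell_unit D_pos]) blast
  have "real_of_int z = real_of_int (int f * int y)"
    using xz(3) fseq_mult_sqrt[of j] sqrt_D_pos y by simp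
  hence z: "z = int f * int y" by linarith
  show "eps K ^ j \<in> pell_units (D * (int f)\<^sup>2)"
    by (rule pell_unitsI[of x _ "int y"])
       (use xz conductor_disc(2)[OF assms] z in \<open>auto simp: power_mult_distrib mult_ac\<close>)
next
  assume "eps K ^ j \<in> pell_units (D * (int f)\<^sup>2)"
  then obtain y :: int where
    "eps K ^ j - inverse (eps K ^ j) = of_int y * sqrt (of_int (D * (int f)\<^sup>2))"
    by (rule pell_unitsE[OF _ conductor_disc(1)[OF assms]]) blast
  hence "real (fseq K j) = of_int (y * int f)"
    unfolding conductor_disc(2)[OF assms] fseq_mult_sqrt[symmetric] using sqrt_D_pos by simp
  hence "int (fseq K j) = y * int f" by linarith
  thus "f dvd fseq K j" by (metis dvd_triv_right int_dvd_int_iff)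
qed

lemma pell_units_conductor_subset: "pell_units (D * (int f)\<^sup>2) \<subseteq> pell_units D"
proof
  fix w assume "w \<in> pell_units (D * (int f)\<^sup>2)"
  then obtain x y where "x\<^sup>2 - D * (int f)\<^sup>2 * y\<^sup>2 = 4"
      "w = (of_int x + of_int y * sqrt (of_int (D * (int f)\<^sup>2))) / 2"
    by (auto simp: pell_units_def)
  thus "w \<in> pell_units D"
    by (intro pell_unitsI[of x _ "y * int f"]) (auto simp: power_mult_distrib mult_ac real_sqrt_mult)
qed

text \<open>The \<open>LEAST\<close> in \<open>jmin\<close> needs a witness. Pell's equation for D
  f^2 gives a unit above 1; it also lies in the larger group for D, so it is a power of
  \<open>eps K\<close>, with positive exponent because it exceeds 1.\<close>

lemma jmin_least:
  assumes "f > 0"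
  shows jmin_pos: "jmin K f > 0" and dvd_fseq_jmin: "f dvd fseq K (jmin K f)"
    and jmin_le: "\<And>j. j > 0 \<Longrightarrow> f dvd fseq K j \<Longrightarrow> jmin K f \<le> j"
proof -
  obtain w where w: "w \<in> pell_units (D * (int f)\<^sup>2)" "w > 1"
    using pell_units_greater_one_exists[OF conductor_disc(3,1)[OF assms]] .
  obtain n where n: "w = eps K powi n"
    using pell_units_cyclic[OF D_pos eps_least, of w] w pell_units_conductor_subset by auto
  have "n > 0"
  proof (rule ccontr)
    assume "\<not> n > 0"
    hence "eps K powi n \<le> eps K powi 0" using eps_gt_1 by (intro power_int_increasing) auto
    thus False using w n by simp
  qed
  hence "w = eps K ^ nat n" using n by (simp add: power_int_def)
  hence "f dvd fseq K (nat n)" using w dvd_fseq_iff[OF assms] by simp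
  hence ex: "nat n \<ge> 1 \<and> f dvd fseq K (nat n)" using \<open>n > 0\<close> by simp
  show "jmin K f > 0" "f dvd fseq K (jmin K f)"
    using LeastI[of "\<lambda>j. j \<ge> 1 \<and> f dvd fseq K j", OF ex] by (auto simp: jmin_def)
  show "\<And>j. j > 0 \<Longrightarrow> f dvd fseq K j \<Longrightarrow> jmin K f \<le> j"
    unfolding jmin_def by (rule Least_le) auto
qed

text \<open>Division with remainder: the admissible exponents are those whose powers lie in a group,
  so the remainder of j modulo \<open>jmin K f\<close> is admissible too, and minimality makes it
  0.\<close>

lemma dvd_fseq_iff_jmin_dvd:
  assumes "f > 0"
  shows "f dvd fseq K j \<longleftrightarrow> jmin K f dvd j"
proof
  let ?U = "pell_units (D * (int f)\<^sup>2)" and ?k = "jmin K f"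
  note pos = conductor_disc(1)[OF assms]
  have k: "eps K ^ ?k \<in> ?U" using dvd_fseq_jmin[OF assms] dvd_fseq_iff[OF assms] by blast
  show "f dvd fseq K j" if dvd: "?k dvd j"
  proof -
    obtain q where "j = ?k * q" using dvd by (elim dvdE)
    hence "eps K ^ j = (eps K ^ ?k) ^ q" by (simp add: power_mult)
    thus ?thesis using dvd_fseq_iff[OF assms] pell_units_power[OF k pos] by simp
  qed
  show "?k dvd j" if "f dvd fseq K j"
  proof -
    have j: "eps K ^ j \<in> ?U" using that dvd_fseq_iff[OF assms] by blast
    have "eps K ^ j = (eps K ^ ?k) ^ (j div ?k) * eps K ^ (j mod ?k)"
      by (simp flip: power_mult power_add)
    hence "eps K ^ (j mod ?k) = eps K ^ j * inverse ((eps K ^ ?k) ^ (j div ?k))"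
      using eps_gt_1 by (simp add: field_simps)
    also have "\<dots> \<in> ?U"
      by (intro pell_units_mult pell_units_inverse_closed pell_units_power j k pos)
    finally have "f dvd fseq K (j mod ?k)" using dvd_fseq_iff[OF assms] by blast
    moreover have "j mod ?k < ?k" using jmin_pos[OF assms] by simp
    ultimately have "j mod ?k = 0" using jmin_le[OF assms, of "j mod ?k"] by linarith
    thus ?thesis by auto
  qed
qed

text \<open>A positive element is a power of \<open>eps K\<close>, whose exponent must be a multiple
  of \<open>jmin K f\<close>; a negative one is handled through its negation.\<close>

lemma norm_one_units_generated:
  assumes "f > 0"
  shows "norm_one_units K f = {s * eps_cond K f powi n | (s::real) (n::int). s = 1 \<or> s = -1}"
proof -
  let ?U = "pell_units (D * (int f)\<^sup>2)" and ?k = "jmin K f"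
  note pos = conductor_disc(1)[OF assms]
  have k: "eps_cond K f \<in> ?U"
    using dvd_fseq_jmin[OF assms] dvd_fseq_iff[OF assms] by (simp add: eps_cond_def)
  have gen: "\<exists>n. w = eps_cond K f powi n" if w: "w \<in> ?U" "w > 0" for w
  proof -
    obtain n where n: "w = eps K powi n"
      using pell_units_cyclic[OF D_pos eps_least, of w] w pell_units_conductor_subset by auto
    \<comment> \<open>The divisibility criterion speaks of natural exponents, so for negative n it
      is applied to the inverse of w.\<close>
    have "eps K ^ nat \<bar>n\<bar> \<in> ?U"
    proof (cases "n \<ge> 0")
      case True
      thus ?thesis using w n by (simp add: power_int_def)
    next
      case False
      hence "inverse w = eps K ^ nat \<bar>n\<bar>" using n by (simp add: power_int_def power_inverse)
      thus ?thesis using pell_units_inverse_closed[OF w(1) pos] by simp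
    qed
    hence "?k dvd nat \<bar>n\<bar>" using dvd_fseq_iff[OF assms] dvd_fseq_iff_jmin_dvd[OF assms] by blast
    hence "int ?k dvd n" by simp
    then obtain m where "n = int ?k * m" by (elim dvdE)
    hence "w = eps_cond K f powi m" using n by (simp add: eps_cond_def power_int_mult)
    thus ?thesis ..
  qed
  show ?thesis unfolding norm_one_units_eq[OF assms]
  proof (intro subset_antisym subsetI)
    fix w assume w: "w \<in> ?U"
    show "w \<in> {s * eps_cond K f powi n | s n. s = 1 \<or> s = -1}"
    proof (cases "w > 0")
      case True
      then obtain n where "w = 1 * eps_cond K f powi n" using gen[OF w] by auto
      thus ?thesis by blast
    next
      case False
      hence "- w > 0" using pell_units_nonzero[OF w pos] by simp
      then obtain n where "- w = eps_cond K f powi n" using gen pell_units_uminus[OF w] by blast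
      hence "w = -1 * eps_cond K f powi n" by simp
      thus ?thesis by blast
    qed
  next
    fix w assume "w \<in> {s * eps_cond K f powi n | s n. s = 1 \<or> s = -1}"
    thus "w \<in> ?U" using pell_units_powi[OF k pos] pell_units_uminus by auto
  qed
qed

text \<open>Minimality gives one inequality. For the other, divisibility bounds
  \<open>fseq K k\<close> by the term at index \<open>jmin K (fseq K k)\<close>, and strict growth
  carries this over to the indices.\<close>

lemma jmin_fseq:
  assumes "k > 0"
  shows "jmin K (fseq K k) = k"
proof (rule antisym)
  note pos = fseq_pos[OF assms]
  show "jmin K (fseq K k) \<le> k" using jmin_le[OF pos] assms by simp
  have "fseq K k \<le> fseq K (jmin K (fseq K k))"
    using dvd_fseq_jmin[OF pos] fseq_pos[OF jmin_pos[OF pos]] by (rule dvd_imp_le)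
  thus "k \<le> jmin K (fseq K k)" using fseq_strict_mono by (simp add: strict_mono_less_eq)
qed

end

text \<open>With D = d or D = 4 d, sqrt D is sqrt d times a nonzero rational c, so irrationality and
  conjugation carry over from sqrt d.\<close>

lemma real_quadratic_field_disc:
  assumes "real_quadratic_field K"
  obtains D where "quadratic_field_disc K D"
proof -
  obtain d :: int where d: "squarefree d" "d > 0" "sqrt (of_int d) \<notin> \<rat>"
    and K: "K = {a + b * sqrt (of_int d) | a b. a \<in> \<rat> \<and> b \<in> \<rat>}"
    using real_quadratic_field_sqrt[OF assms] .
  define D where "D = (if d mod 4 = 1 then d else 4 * d)"
  define c :: real where "c = (if d mod 4 = 1 then 1 else 2)"
  have c: "c \<in> \<rat>" "c \<noteq> 0" by (auto simp: c_def)
  have sqrt_D: "sqrt (of_int D) = c * sqrt (of_int d)"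
    by (simp add: D_def c_def real_sqrt_mult)
  have "quadratic_field_disc K D"
  proof
    show "sqrt (of_int D) \<notin> \<rat>"
    proof
      assume "sqrt (of_int D) \<in> \<rat>"
      hence "sqrt (of_int D) / c \<in> \<rat>" using c by simp
      thus False using c d(3) by (simp add: sqrt_D)
    qed
    show "D > 0" using d(2) by (simp add: D_def)
    show "ring_of_integers K =
        {of_int m + of_int n * ((of_int D + sqrt (of_int D)) / 2) | m n :: int. True}"
      using ring_of_integers_sqrt[OF d K D_def] .
    show "quad_conj K (a + b * sqrt (of_int D)) = a - b * sqrt (of_int D)"
      if "a \<in> \<rat>" "b \<in> \<rat>" for a b
      using quad_conj_eq[OF d(3,2) K, of a "b * c"] that c by (simp add: sqrt_D mult.assoc)
  qed
  thus thesis by (rule that)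
qed

theorem theorem4p14:
  fixes K :: "real set"
  assumes "real_quadratic_field K"
  shows "(\<forall>f>0. norm_one_units K f =
            {s * eps_cond K f powi n | (s::real) (n::int). s = 1 \<or> s = -1})
       \<and> (\<forall>k>0. jmin K (fseq K k) = k)
       \<and> (\<forall>f>0. \<forall>j>0. f dvd fseq K j \<longleftrightarrow> jmin K f dvd j)
       \<and> (\<forall>j>0. \<forall>k>0. j dvd k \<longleftrightarrow> fseq K j dvd fseq K k)"
proof -
  obtain D where "quadratic_field_disc K D" using real_quadratic_field_disc[OF assms] .
  then interpret quadratic_field_disc K D .
  \<comment> \<open>The fourth claim is the third for the conductor \<open>fseq K j\<close>, whose
    \<open>jmin\<close> is j by the second.\<close>
  show ?thesis
    using norm_one_units_generated jmin_fseq dvd_fseq_iff_jmin_dvd fseq_pos by simp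
qed

end
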